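(* For every measurable $F:\Omega\to\mathbb R$, and for each choice of sign $\pm$, $$E\left[|D^\pm F|_{L^1(\sigma)}\right]=\int_{-\infty}^{+\infty}E\left[|D^\pm1_{\{F>t\}}|_{L^1(\sigma)}\right]dt,\qquad E\left[|D^\pm F|_{L^1(\omega)}\right]=\int_{-\infty}^{+\infty}E\left[|D^\pm1_{\{F>t\}}|_{L^1(\omega)}\right]dt.$$
   Context: $X$ is a metric space with Borel $\sigma$-algebra $\mathcal B(X)$ and $\sigma$ is a finite diffuse (atomless) measure on $X$. $\Omega$ is the set of Radon measures $\omega=\sum_{i=1}^N\delta_{x_i}$ with pairwise distinct $x_i\in X$, $N\in\mathbb N\cup\{\infty\}$; $\omega$ is identified with the set $\{x_1,x_2,\dots\}$. $\mathcal F$ is the $\sigma$-algebra generated by the maps $\omega\mapsto\omega(B)$, $B\in\mathcal B(X)$, and $\pi$ is the Poisson measure on $(\Omega,\mathcal F)$ with intensity $\sigma$; $E$ is expectation under $\pi$. $D_xF(\omega)=(F(\omega)-F(\omega+\delta_x))1_{\{x\notin\omega\}}+(F(\omega)-F(\omega-\delta_x))1_{\{x\in\omega\}}$, $D_x^+F=\max(0,D_xF)$, $D_x^-F=-\min(0,D_xF)$. For each $\omega$, $|D^\pm F(\omega)|_{L^1(\sigma)}=\int_XD_x^\pm F(\omega)\,\sigma(dx)$ and $|D^\pm F(\omega)|_{L^1(\omega)}=\int_XD_x^\pm F(\omega)\,\omega(dx)$. Both sides are allowed to be $+\infty$. *)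

theory Defs
  imports "HOL-Probability.Probability" "HOL-Library.Extended_Nat"
begin

definition radon_measure :: "'a::metric_space measure \<Rightarrow> bool" where
  "radon_measure \<mu> \<longleftrightarrow>
     sets \<mu> = sets borel \<and>
     (\<forall>K. compact K \<longrightarrow> emeasure \<mu> K < \<infinity>) \<and>
     (\<forall>B\<in>sets borel. emeasure \<mu> B = (SUP K\<in>{K. compact K \<and> K \<subseteq> B}. emeasure \<mu> K))"

abbreviation dirac :: "'a::metric_space \<Rightarrow> 'a measure" where
  "dirac x \<equiv> return borel x"

text \<open>The sum of the \<open>N\<close> Dirac measures is an integral against counting measure on the index
  set; \<open>N = 0\<close> gives the zero measure (the empty configuration).\<close>

definition configurations :: "'a::metric_space measure set" where
  "configurations =
     {\<omega>. radon_measure \<omega> \<and>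
          (\<exists>(N::enat) (x::nat \<Rightarrow> 'a). inj_on x {i. enat i < N} \<and>
             (\<forall>B\<in>sets borel.
                emeasure \<omega> B = (\<integral>\<^sup>+ i. emeasure (dirac (x i)) B \<partial>count_space {i. enat i < N})))}"

definition points :: "'a::metric_space measure \<Rightarrow> 'a set" where
  "points \<omega> = {x. emeasure \<omega> {x} \<noteq> 0}"

definition config_space :: "'a::metric_space measure measure" where
  "config_space =
     sigma configurations
       {{\<omega> \<in> configurations. emeasure \<omega> B \<in> A} | B A. B \<in> sets borel \<and> A \<in> sets borel}"

definition diffuse :: "'a::metric_space measure \<Rightarrow> bool" where
  "diffuse \<sigma> \<longleftrightarrow> (\<forall>x. emeasure \<sigma> {x} = 0)"

text \<open>The intensity is meant to be finite, so every count has a finite Poisson parameter.  The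
  density is written out because \<^const>\<open>poisson_pmf\<close> is specified for positive rates only, whereas
  \<open>\<sigma>(B) = 0\<close> has to be covered here (using \<open>0 ^ 0 = 1\<close>).\<close>

definition poisson_measure :: "'a::metric_space measure \<Rightarrow> 'a measure measure \<Rightarrow> bool" where
  "poisson_measure \<sigma> \<pi> \<longleftrightarrow>
     prob_space \<pi> \<and> sets \<pi> = sets config_space \<and>
     (\<forall>B\<in>sets borel. \<forall>k::nat.
        measure \<pi> {\<omega> \<in> space \<pi>. emeasure \<omega> B = of_nat k} =
          measure \<sigma> B ^ k / fact k * exp (- measure \<sigma> B)) \<and>
     (\<forall>(n::nat) B. (\<forall>i<n. B i \<in> sets borel) \<and> disjoint_family_on B {..<n} \<longrightarrow>
        prob_space.indep_vars \<pi> (\<lambda>_. borel) (\<lambda>i \<omega>. emeasure \<omega> (B i)) {..<n})"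

definition add_measure :: "'a measure \<Rightarrow> 'a measure \<Rightarrow> 'a measure" where
  "add_measure \<mu> \<nu> = measure_of (space \<mu>) (sets \<mu>) (\<lambda>A. emeasure \<mu> A + emeasure \<nu> A)"

lemma emeasure_add_measure:
  assumes "sets \<mu> = sets \<nu>" "A \<in> sets \<mu>"
  shows "emeasure (add_measure \<mu> \<nu>) A = emeasure \<mu> A + emeasure \<nu> A"
  unfolding add_measure_def
proof (rule emeasure_measure_of_sigma)
  show "countably_additive (sets \<mu>) (\<lambda>A. emeasure \<mu> A + emeasure \<nu> A)"
    using assms(1) by (auto simp: countably_additive_def suminf_add[symmetric] suminf_emeasure)
qed (use assms sets.sigma_algebra_axioms[of \<mu>] in \<open>auto simp: positive_def\<close>)

text \<open>On a configuration without (resp. with) the point \<open>x\<close>, the first (resp. second) summand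
  evaluates \<open>F\<close> at configurations only; the other summand vanishes, so the values of \<open>F\<close> outside
  \<^const>\<open>configurations\<close> play no role.\<close>

definition diff_op :: "('a::metric_space measure \<Rightarrow> real) \<Rightarrow> 'a \<Rightarrow> 'a measure \<Rightarrow> real" where
  "diff_op F x \<omega> =
     (F \<omega> - F (add_measure \<omega> (dirac x))) * of_bool (x \<notin> points \<omega>) +
     (F \<omega> - F (diff_measure \<omega> (dirac x))) * of_bool (x \<in> points \<omega>)"

definition diff_op_pos :: "('a::metric_space measure \<Rightarrow> real) \<Rightarrow> 'a \<Rightarrow> 'a measure \<Rightarrow> real" where
  "diff_op_pos F x \<omega> = max 0 (diff_op F x \<omega>)"

definition diff_op_neg :: "('a::metric_space measure \<Rightarrow> real) \<Rightarrow> 'a \<Rightarrow> 'a measure \<Rightarrow> real" where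
  "diff_op_neg F x \<omega> = - min 0 (diff_op F x \<omega>)"

text \<open>For each \<open>\<omega>\<close>, the norm is taken with \<open>\<mu> = \<sigma>\<close> or \<open>\<mu> = \<omega>\<close>.\<close>

definition L1_pos ::
    "('a::metric_space measure \<Rightarrow> real) \<Rightarrow> 'a measure \<Rightarrow> 'a measure \<Rightarrow> ennreal" where
  "L1_pos F \<omega> \<mu> = (\<integral>\<^sup>+ x. ennreal (diff_op_pos F x \<omega>) \<partial>\<mu>)"

definition L1_neg ::
    "('a::metric_space measure \<Rightarrow> real) \<Rightarrow> 'a measure \<Rightarrow> 'a measure \<Rightarrow> ennreal" where
  "L1_neg F \<omega> \<mu> = (\<integral>\<^sup>+ x. ennreal (diff_op_neg F x \<omega>) \<partial>\<mu>)"

end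

theory Submission
  imports Defs
begin

text \<open>
  Every neighbour difference satisfies
  \<open>max 0 (a - b) = \<integral> 1{b \<le> t < a} dt\<close>, and the integrand is the positive part of the difference of
  \<open>1{F > t}\<close>; the identities follow by exchanging integrals. The difficulty is joint measurability,
  since \<open>X\<close> need not be separable and \<open>{(\<omega>, x). x \<in> \<omega>}\<close> need not be product measurable. It is
  avoided by factoring \<open>F = f \<circ> (\<lambda>\<omega>. (\<omega>(B))\<^sub>B)\<close> with \<open>f\<close> measurable on the product space indexed by the
  Borel sets: \<open>(\<omega>, x) \<mapsto> f ((\<omega>(B) \<plusminus> 1\<^sub>B(x))\<^sub>B)\<close> is jointly measurable and equals \<open>F (\<omega> \<plusminus> \<delta>\<^sub>x)\<close> for
  \<open>\<sigma>\<close>-almost all, respectively \<open>\<omega>\<close>-almost all, \<open>x\<close>. Moreover \<open>\<omega>\<close> is \<open>\<pi>\<close>-almost surely finite, so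
  \<open>\<omega> \<mapsto> \<omega>\<close> is, up to a null set, a kernel of finite measures.
\<close>

section \<open>Factorisation of measurable functions and integration against finite kernels\<close>

text \<open>This is the Doob-Dynkin lemma. Functions that factor through \<open>g\<close> include
  the indicators of preimages and are stable under scaling, sums and monotone limits, which covers
  nonnegative functions; positive and negative parts do the rest.\<close>

lemma borel_measurable_vimage_algebra_factor:
  fixes u :: "'a \<Rightarrow> real"
  assumes g: "g \<in> X \<rightarrow> space N" and u: "u \<in> borel_measurable (vimage_algebra X g N)"
  obtains v where "v \<in> borel_measurable N" "\<And>x. x \<in> X \<Longrightarrow> u x = v (g x)"
proof -
  let ?M = "vimage_algebra X g N"
  let ?P = "\<lambda>u :: 'a \<Rightarrow> real. \<exists>v\<in>borel_measurable N. \<forall>x\<in>X. u x = v (g x)"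
  have nonneg: "?P w" if "w \<in> borel_measurable ?M" "\<And>x. 0 \<le> w x" for w
    using that
  proof (induction rule: borel_measurable_induct_real)
    case (set A)
    then obtain B where B: "B \<in> sets N" "A = g -` B \<inter> X"
      using sets_vimage_algebra2[OF g] by auto
    then show ?case
      by (intro bexI[of _ "indicator B"]) (auto split: split_indicator)
  next
    case (mult u c)
    then obtain v where "v \<in> borel_measurable N" "\<forall>x\<in>X. u x = v (g x)" by blast
    then show ?case by (intro bexI[of _ "\<lambda>y. c * v y"]) auto
  next
    case (add u v)
    then obtain u' v' where "u' \<in> borel_measurable N" "\<forall>x\<in>X. u x = u' (g x)"
      "v' \<in> borel_measurable N" "\<forall>x\<in>X. v x = v' (g x)" by blast
    then show ?case by (intro bexI[of _ "\<lambda>y. v' y + u' y"]) auto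
  next
    case (seq U)
    then obtain V where V: "\<And>i. V i \<in> borel_measurable N" "\<And>i x. x \<in> X \<Longrightarrow> U i x = V i (g x)"
      by metis
    \<comment> \<open>The \<open>V i\<close> are only known to converge on the range of
      \<open>g\<close>. Since \<open>lim\<close> is total and preserves measurability, its value
      elsewhere is harmless.\<close>
    have "w x = lim (\<lambda>i. V i (g x))" if "x \<in> X" for x
    proof -
      have "(\<lambda>i. U i x) \<longlonglongrightarrow> w x" using seq that by simp
      then show ?thesis using V(2)[OF that] by (simp add: limI)
    qed
    with V(1) show ?case
      by (intro bexI[of _ "\<lambda>y. lim (\<lambda>i. V i y)"]) auto
  qed
  obtain v1 where v1: "v1 \<in> borel_measurable N" "\<forall>x\<in>X. max 0 (u x) = v1 (g x)"
    using nonneg[OF borel_measurable_max[OF u borel_measurable_const] max.cobounded1] by blast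
  obtain v2 where v2: "v2 \<in> borel_measurable N" "\<forall>x\<in>X. max 0 (- u x) = v2 (g x)"
    using nonneg[OF borel_measurable_max[OF borel_measurable_uminus[OF u] borel_measurable_const]
        max.cobounded1] by blast
  show thesis
  proof
    show "(\<lambda>y. v1 y - v2 y) \<in> borel_measurable N" using v1 v2 by simp
    show "u x = v1 (g x) - v2 (g x)" if "x \<in> X" for x
    proof -
      have "u x = max 0 (u x) - max 0 (- u x)" by (simp add: max_def)
      then show ?thesis using v1(2) v2(2) that by metis
    qed
  qed
qed

text \<open>Here the measure in the inner integral varies with \<open>x\<close>, as it must when a
  configuration is integrated against itself, so measurability for a fixed product measure does not
  suffice.\<close>

lemma borel_measurable_nn_integral_finite_kernel:
  fixes K :: "'a \<Rightarrow> 'b measure" and f :: "'a \<times> 'b \<Rightarrow> ennreal"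
  assumes sets_K: "\<And>x. x \<in> space M \<Longrightarrow> sets (K x) = sets N"
    and fin: "\<And>x. x \<in> space M \<Longrightarrow> finite_measure (K x)"
    and K: "\<And>A. A \<in> sets N \<Longrightarrow> (\<lambda>x. emeasure (K x) A) \<in> borel_measurable M"
    and f: "f \<in> borel_measurable (M \<Otimes>\<^sub>M N)"
  shows "(\<lambda>x. \<integral>\<^sup>+ y. f (x, y) \<partial>K x) \<in> borel_measurable M"
proof (cases "space N = {}")
  \<comment> \<open>Subprobability spaces are nonempty by definition, so an empty \<open>N\<close>
    is treated apart.\<close>
  case True
  have "(\<integral>\<^sup>+ y. f (x, y) \<partial>K x) = 0" if "x \<in> space M" for x
    using sets_eq_imp_space_eq[OF sets_K[OF that]] True by (intro nn_integral_empty) simp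
  then show ?thesis
    by (subst measurable_cong) auto
next
  case False
  have [measurable]: "(\<lambda>x. emeasure (K x) (space N)) \<in> borel_measurable M"
    using K by simp
  note f[measurable]
  \<comment> \<open>Normalising by \<open>c\<close> reduces the claim to the library result on subprobability kernels.\<close>
  define c where "c x = 1 + emeasure (K x) (space N)" for x
  have [measurable]: "c \<in> borel_measurable M"
    unfolding c_def by measurable
  define L where "L x = scale_measure (inverse (c x)) (K x)" for x
  \<comment> \<open>The summand 1 in \<open>c\<close> keeps it invertible where \<open>K x\<close>
    is the zero measure; finiteness of \<open>K x\<close> keeps it below infinity.\<close>
  have c: "c x \<noteq> 0" "c x \<noteq> \<top>" "emeasure (K x) (space N) \<le> c x" if "x \<in> space M" for x
  proof -
    have "emeasure (K x) (space N) \<noteq> \<top>"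
      using finite_measure.emeasure_finite[OF fin[OF that]] by auto
    then show "c x \<noteq> 0" "c x \<noteq> \<top>" "emeasure (K x) (space N) \<le> c x"
      unfolding c_def by (auto simp: add_eq_0_iff_both_eq_0)
  qed
  have L: "L \<in> measurable M (subprob_algebra N)"
  proof (rule measurable_subprob_algebra)
    fix x assume x: "x \<in> space M"
    have sp: "space (K x) = space N" using sets_eq_imp_space_eq[OF sets_K[OF x]] .
    show sets_L: "sets (L x) = sets N" using sets_K[OF x] by (simp add: L_def)
    show "subprob_space (L x)"
    proof (rule subprob_spaceI)
      have "emeasure (L x) (space (L x)) = emeasure (K x) (space N) / c x"
        by (simp add: L_def sp divide_ennreal_def mult.commute space_scale_measure)
      also have "\<dots> \<le> 1"
        using c[OF x] by (simp add: divide_le_posI_ennreal zero_less_iff_neq_zero)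
      finally show "emeasure (L x) (space (L x)) \<le> 1" .
      show "space (L x) \<noteq> {}" using False sets_eq_imp_space_eq[OF sets_L] by simp
    qed
  next
    fix A assume "A \<in> sets N"
    then have [measurable]: "(\<lambda>x. emeasure (K x) A) \<in> borel_measurable M" by (rule K)
    show "(\<lambda>x. emeasure (L x) A) \<in> borel_measurable M" unfolding L_def by simp
  qed
  have "(\<lambda>x. c x * (\<integral>\<^sup>+ y. f (x, y) \<partial>L x)) \<in> borel_measurable M"
    using nn_integral_measurable_subprob_algebra2[OF _ L, of "\<lambda>x y. f (x, y)"] by simp
  also have "?this \<longleftrightarrow> ?thesis"
  proof (rule measurable_cong)
    fix x assume x: "x \<in> space M"
    have [measurable]: "(\<lambda>y. f (x, y)) \<in> borel_measurable N" using x by measurable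
    then have "(\<lambda>y. f (x, y)) \<in> borel_measurable (K x)"
      using measurable_cong_sets[OF sets_K[OF x] refl] by blast
    then have "c x * (\<integral>\<^sup>+ y. f (x, y) \<partial>L x) = (c x * inverse (c x)) * (\<integral>\<^sup>+ y. f (x, y) \<partial>K x)"
      by (simp add: L_def nn_integral_scale_measure mult.assoc)
    also have "c x * inverse (c x) = 1"
      using c[OF x] by (metis ennreal_divide_self divide_ennreal_def top.not_eq_extremum)
    finally show "c x * (\<integral>\<^sup>+ y. f (x, y) \<partial>L x) = (\<integral>\<^sup>+ y. f (x, y) \<partial>K x)" by simp
  qed
  finally show ?thesis .
qed

section \<open>The coarea formula along a finite kernel\<close>

text \<open>The integrand is the indicator of \<open>{b..<a}\<close>, whose length is the left side.
  The interval is closed at \<open>b\<close> and open at \<open>a\<close> because these are the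
  levels \<open>t\<close> with \<open>a > t\<close> but not \<open>b > t\<close>.\<close>

lemma ennreal_max_0_diff_eq_nn_integral:
  fixes a b :: real
  shows "ennreal (max 0 (a - b)) = (\<integral>\<^sup>+ t. (if b \<le> t \<and> t < a then 1 else 0) \<partial>lborel)"
proof -
  have "(\<integral>\<^sup>+ t. (if b \<le> t \<and> t < a then 1 else 0 :: ennreal) \<partial>lborel) =
    (\<integral>\<^sup>+ t. indicator {b..<a} t \<partial>lborel)"
    by (intro nn_integral_cong) (auto split: split_indicator)
  also have "\<dots> = emeasure lborel {b..<a}" by simp
  also have "\<dots> = ennreal (max 0 (a - b))"
    by (cases "b \<le> a") (auto simp: max_def)
  finally show ?thesis by simp
qed

text \<open>The level \<open>t\<close> is moved outwards in two Tonelli steps: past \<open>y\<close>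
  with \<open>x\<close> fixed, where \<open>K x\<close> is one finite measure, and then past
  \<open>x\<close>.\<close>

lemma coarea_finite_kernel:
  fixes P :: "'a measure" and K :: "'a \<Rightarrow> 'b measure" and a b :: "'a \<times> 'b \<Rightarrow> real"
  assumes P: "sigma_finite_measure P"
    and sets_K: "\<And>x. x \<in> space P \<Longrightarrow> sets (K x) = sets N"
    and fin: "\<And>x. x \<in> space P \<Longrightarrow> finite_measure (K x)"
    and K: "\<And>A. A \<in> sets N \<Longrightarrow> (\<lambda>x. emeasure (K x) A) \<in> borel_measurable P"
    and a[measurable]: "a \<in> borel_measurable (P \<Otimes>\<^sub>M N)"
    and b[measurable]: "b \<in> borel_measurable (P \<Otimes>\<^sub>M N)"
  shows "(\<integral>\<^sup>+ x. \<integral>\<^sup>+ y. ennreal (max 0 (a (x, y) - b (x, y))) \<partial>K x \<partial>P) =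
    (\<integral>\<^sup>+ t. \<integral>\<^sup>+ x. \<integral>\<^sup>+ y. (if b (x, y) \<le> t \<and> t < a (x, y) then 1 else 0) \<partial>K x \<partial>P \<partial>lborel)"
proof -
  interpret P: sigma_finite_measure P by fact
  interpret PL: pair_sigma_finite P lborel ..
  let ?g = "\<lambda>x t y. (if b (x, y) \<le> t \<and> t < a (x, y) then 1 else 0 :: ennreal)"
  have "(\<integral>\<^sup>+ y. ennreal (max 0 (a (x, y) - b (x, y))) \<partial>K x) = (\<integral>\<^sup>+ t. \<integral>\<^sup>+ y. ?g x t y \<partial>K x \<partial>lborel)"
    if x: "x \<in> space P" for x
  proof -
    interpret Kx: finite_measure "K x" by (rule fin[OF x])
    interpret KL: pair_sigma_finite "K x" lborel ..
    note [measurable_cong] = sets_K[OF x]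
    note x[measurable]
    have "(\<lambda>(y, t). ?g x t y) \<in> borel_measurable (K x \<Otimes>\<^sub>M lborel)"
      by measurable
    from KL.Fubini'[OF this] show ?thesis
      by (simp only: ennreal_max_0_diff_eq_nn_integral prod.case)
  qed
  then have "(\<integral>\<^sup>+ x. \<integral>\<^sup>+ y. ennreal (max 0 (a (x, y) - b (x, y))) \<partial>K x \<partial>P) =
      (\<integral>\<^sup>+ x. \<integral>\<^sup>+ t. \<integral>\<^sup>+ y. ?g x t y \<partial>K x \<partial>lborel \<partial>P)"
    by (rule nn_integral_cong)
  also have "\<dots> = (\<integral>\<^sup>+ t. \<integral>\<^sup>+ x. \<integral>\<^sup>+ y. ?g x t y \<partial>K x \<partial>P \<partial>lborel)"
  proof (rule PL.Fubini'[symmetric])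
    let ?f = "\<lambda>z. ?g (fst (fst z)) (snd (fst z)) (snd z)"
    have f: "?f \<in> borel_measurable ((P \<Otimes>\<^sub>M lborel) \<Otimes>\<^sub>M N)"
      by measurable
    \<comment> \<open>The second exchange needs joint measurability in \<open>(x, t)\<close>. It
      comes from viewing \<open>K\<close> as a kernel on pairs that ignores
      \<open>t\<close>.\<close>
    have "(\<lambda>z. \<integral>\<^sup>+ y. ?f (z, y) \<partial>K (fst z)) \<in> borel_measurable (P \<Otimes>\<^sub>M lborel)"
    proof (rule borel_measurable_nn_integral_finite_kernel[OF _ _ _ f])
      show "(\<lambda>z. emeasure (K (fst z)) A) \<in> borel_measurable (P \<Otimes>\<^sub>M lborel)" if "A \<in> sets N" for A
        by (rule measurable_compose[OF measurable_fst K[OF that]])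
    qed (use sets_K fin in \<open>auto simp: space_pair_measure\<close>)
    then show "(\<lambda>(x, t). \<integral>\<^sup>+ y. ?g x t y \<partial>K x) \<in> borel_measurable (P \<Otimes>\<^sub>M lborel)"
      by (simp add: split_beta')
  qed
  finally show ?thesis .
qed

section \<open>Configurations as counting measures of countable sets\<close>

text \<open>Summing Dirac measures along an injective enumeration counts the points of its range,
  and every countable set has such an enumeration, with \<open>N\<close> its cardinality. Working
  with the set makes it easy to add or delete a point.\<close>

lemma configurations_iff_countable_set:
  fixes \<omega> :: "'a::metric_space measure"
  shows "\<omega> \<in> configurations \<longleftrightarrow> radon_measure \<omega> \<and>
    (\<exists>S. countable S \<and> (\<forall>B\<in>sets borel. emeasure \<omega> B = emeasure (count_space UNIV) (B \<inter> S)))"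
proof -
  have sum_dirac: "(\<integral>\<^sup>+ i. emeasure (dirac (x i)) B \<partial>count_space {i. enat i < N}) =
      emeasure (count_space UNIV) (B \<inter> S)"
    if x: "bij_betw x {i. enat i < N} S" and B: "B \<in> sets borel" for x :: "nat \<Rightarrow> 'a" and N S B
  proof -
    have "(\<integral>\<^sup>+ i. emeasure (dirac (x i)) B \<partial>count_space {i. enat i < N}) =
        (\<integral>\<^sup>+ i. indicator B (x i) \<partial>count_space {i. enat i < N})"
      using B by (intro nn_integral_cong) simp
    also have "\<dots> = (\<integral>\<^sup>+ y. indicator B y \<partial>count_space S)"
      by (rule nn_integral_bij_count_space[OF x])
    also have "\<dots> = (\<integral>\<^sup>+ y. indicator (B \<inter> S) y \<partial>count_space UNIV)"
      by (subst nn_integral_count_space_indicator)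
        (auto simp flip: indicator_inter_arith simp: mult.commute Int_commute)
    also have "\<dots> = emeasure (count_space UNIV) (B \<inter> S)"
      by (rule nn_integral_indicator) simp
    finally show ?thesis .
  qed
  have "\<exists>(N::enat) (x::nat \<Rightarrow> 'a). bij_betw x {i. enat i < N} S" if "countable S" for S
  proof (cases "finite S")
    case True
    then obtain h where "bij_betw h {0..<card S} S" using ex_bij_betw_nat_finite by blast
    moreover have "{0..<card S} = {i. enat i < enat (card S)}" by auto
    ultimately show ?thesis by metis
  next
    case False
    then have "bij_betw (from_nat_into S) {i. enat i < \<infinity>} S"
      using bij_betw_from_nat_into[OF that] by simp
    then show ?thesis by blast
  qed
  then have 1: "\<omega> \<in> configurations"
    if "radon_measure \<omega>" "countable S" "\<forall>B\<in>sets borel. emeasure \<omega> B = emeasure (count_space UNIV) (B \<inter> S)" for S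
    using that sum_dirac unfolding configurations_def mem_Collect_eq
    by (metis bij_betw_imp_inj_on)
  have 2: "\<exists>S. countable S \<and> (\<forall>B\<in>sets borel. emeasure \<omega> B = emeasure (count_space UNIV) (B \<inter> S))"
    if w: "\<omega> \<in> configurations"
  proof -
    obtain N :: enat and x :: "nat \<Rightarrow> 'a" where x: "inj_on x {i. enat i < N}"
      "\<forall>B\<in>sets borel. emeasure \<omega> B = (\<integral>\<^sup>+ i. emeasure (dirac (x i)) B \<partial>count_space {i. enat i < N})"
      using w unfolding configurations_def by blast
    show ?thesis
      using x(2) sum_dirac[OF inj_on_imp_bij_betw[OF x(1)]]
      by (intro exI[of _ "x ` {i. enat i < N}"]) auto
  qed
  have "radon_measure \<omega>" if "\<omega> \<in> configurations"
    using that by (simp add: configurations_def)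
  with 1 2 show ?thesis by blast
qed

text \<open>Singletons are Borel, and their masses already determine \<open>S\<close>.\<close>

lemma points_eq:
  assumes "\<forall>B\<in>sets borel. emeasure \<omega> B = emeasure (count_space UNIV) (B \<inter> S)"
  shows "points \<omega> = S"
proof -
  have "emeasure \<omega> {x} \<noteq> 0 \<longleftrightarrow> x \<in> S" for x
    using assms by (cases "x \<in> S") auto
  then show ?thesis by (auto simp: points_def)
qed

lemma
  assumes "\<omega> \<in> configurations"
  shows sets_configuration: "sets \<omega> = sets borel"
    and countable_points: "countable (points \<omega>)"
    and emeasure_configuration:
      "B \<in> sets borel \<Longrightarrow> emeasure \<omega> B = emeasure (count_space UNIV) (B \<inter> points \<omega>)"
proof -
  obtain S where S: "countable S"
    "\<forall>B\<in>sets borel. emeasure \<omega> B = emeasure (count_space UNIV) (B \<inter> S)"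
    using assms unfolding configurations_iff_countable_set by blast
  then show "countable (points \<omega>)"
    and "B \<in> sets borel \<Longrightarrow> emeasure \<omega> B = emeasure (count_space UNIV) (B \<inter> points \<omega>)"
    by (simp_all add: points_eq[OF S(2)])
  show "sets \<omega> = sets borel"
    using assms by (simp add: configurations_def radon_measure_def)
qed

text \<open>The complement of the countable set \<open>points \<omega>\<close> is Borel and contains
  no point to count. Under \<omega> itself only the deletion branch of \<open>diff_op\<close> is
  therefore seen.\<close>

lemma AE_configuration_points:
  assumes "\<omega> \<in> configurations"
  shows "AE x in \<omega>. x \<in> points \<omega>"
proof (rule AE_I')
  have "- points \<omega> \<in> sets borel"
    using sets.countable[OF _ countable_points[OF assms], of borel] by (auto intro: borel_comp)
  then show "- points \<omega> \<in> null_sets \<omega>"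
    using assms by (auto simp: null_sets_def sets_configuration emeasure_configuration)
qed auto

section \<open>Adding and deleting a point\<close>

text \<open>Inner regularity survives because a compact subset of \<open>B\<close> stays compact,
  and inside \<open>B\<close>, after the point \<open>x\<close> of \<open>B\<close> is
  inserted.\<close>

lemma radon_measure_add_dirac:
  fixes \<omega> :: "'a::metric_space measure"
  assumes "radon_measure \<omega>"
  shows "radon_measure (add_measure \<omega> (dirac x))"
proof -
  have sets_w: "sets \<omega> = sets borel"
    and fin: "\<And>K. compact K \<Longrightarrow> emeasure \<omega> K < \<infinity>"
    and inner: "\<And>B. B \<in> sets borel \<Longrightarrow> emeasure \<omega> B = (SUP K\<in>{K. compact K \<and> K \<subseteq> B}. emeasure \<omega> K)"
    using assms by (auto simp: radon_measure_def)
  let ?m = "add_measure \<omega> (dirac x)"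
  have m: "emeasure ?m B = emeasure \<omega> B + indicator B x" if "B \<in> sets borel" for B
    using that sets_w by (simp add: emeasure_add_measure)
  have sets_m: "sets ?m = sets borel"
    unfolding add_measure_def using sets.sets_measure_of_eq[of \<omega>] sets_w by simp
  have cpt: "K \<in> sets borel" if "compact K" for K :: "'a set"
    using that by (simp add: borel_closed compact_imp_closed)
  have "emeasure ?m B = (SUP K\<in>{K. compact K \<and> K \<subseteq> B}. emeasure ?m K)" if B: "B \<in> sets borel" for B
  proof (rule antisym)
    have "emeasure ?m B = (SUP K\<in>{K. compact K \<and> K \<subseteq> B}. emeasure \<omega> K) + indicator B x"
      using m[OF B] inner[OF B] by simp
    \<comment> \<open>The constant may enter the supremum because the index family is nonempty: the
      empty set is compact.\<close>
    also have "\<dots> = (SUP K\<in>{K. compact K \<and> K \<subseteq> B}. emeasure \<omega> K + indicator B x)"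
      by (rule ennreal_SUP_add_left[symmetric]) auto
    also have "\<dots> \<le> (SUP K\<in>{K. compact K \<and> K \<subseteq> B}. emeasure ?m K)"
    proof (rule SUP_least)
      fix K assume K: "K \<in> {K. compact K \<and> K \<subseteq> B}"
      let ?K = "if x \<in> B then insert x K else K"
      have K': "compact ?K" "?K \<subseteq> B" using K by auto
      have "emeasure \<omega> K + indicator B x \<le> emeasure \<omega> ?K + indicator ?K x"
        using cpt[OF K'(1)] sets_w by (intro add_mono emeasure_mono) auto
      also have "\<dots> = emeasure ?m ?K" using m[OF cpt[OF K'(1)]] by simp
      also have "\<dots> \<le> (SUP K\<in>{K. compact K \<and> K \<subseteq> B}. emeasure ?m K)"
        using K' by (intro SUP_upper) auto
      finally show "emeasure \<omega> K + indicator B x \<le> \<dots>" .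
    qed
    finally show "emeasure ?m B \<le> \<dots>" .
    show "(SUP K\<in>{K. compact K \<and> K \<subseteq> B}. emeasure ?m K) \<le> emeasure ?m B"
      using B sets_m by (intro SUP_least emeasure_mono) auto
  qed
  moreover have "emeasure ?m K < \<infinity>" if "compact K" for K
    using fin[OF that] by (simp add: m[OF cpt[OF that]] indicator_def)
  ultimately show ?thesis
    unfolding radon_measure_def using sets_m by blast
qed

text \<open>Inner regularity of \<omega> is applied to \<open>B - {x}\<close>: on compact sets that
  avoid \<open>x\<close> the two measures agree.\<close>

lemma radon_measure_remove_point:
  fixes \<omega> :: "'a::metric_space measure"
  assumes "radon_measure \<omega>" and sets_m: "sets \<mu> = sets borel"
    and m: "\<And>B. B \<in> sets borel \<Longrightarrow> emeasure \<mu> B = emeasure \<omega> (B - {x})"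
  shows "radon_measure \<mu>"
proof -
  have sets_w: "sets \<omega> = sets borel"
    and fin: "\<And>K. compact K \<Longrightarrow> emeasure \<omega> K < \<infinity>"
    and inner: "\<And>B. B \<in> sets borel \<Longrightarrow> emeasure \<omega> B = (SUP K\<in>{K. compact K \<and> K \<subseteq> B}. emeasure \<omega> K)"
    using assms(1) by (auto simp: radon_measure_def)
  have cpt: "K \<in> sets borel" if "compact K" for K :: "'a set"
    using that by (simp add: borel_closed compact_imp_closed)
  have "emeasure \<mu> B = (SUP K\<in>{K. compact K \<and> K \<subseteq> B}. emeasure \<mu> K)" if B: "B \<in> sets borel" for B
  proof (rule antisym)
    have "emeasure \<mu> B = (SUP K\<in>{K. compact K \<and> K \<subseteq> B - {x}}. emeasure \<omega> K)"
      using m[OF B] inner[of "B - {x}"] B by simp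
    also have "\<dots> \<le> (SUP K\<in>{K. compact K \<and> K \<subseteq> B}. emeasure \<mu> K)"
    proof (rule SUP_least)
      fix K assume K: "K \<in> {K. compact K \<and> K \<subseteq> B - {x}}"
      then have "K - {x} = K" by auto
      with K have "emeasure \<omega> K = emeasure \<mu> K" using m[of K] cpt by simp
      also have "\<dots> \<le> (SUP K\<in>{K. compact K \<and> K \<subseteq> B}. emeasure \<mu> K)"
        using K by (intro SUP_upper) auto
      finally show "emeasure \<omega> K \<le> \<dots>" .
    qed
    finally show "emeasure \<mu> B \<le> \<dots>" .
    show "(SUP K\<in>{K. compact K \<and> K \<subseteq> B}. emeasure \<mu> K) \<le> emeasure \<mu> B"
      using B sets_m by (intro SUP_least emeasure_mono) auto
  qed
  moreover have "emeasure \<mu> K < \<infinity>" if "compact K" for K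
  proof -
    have "emeasure \<mu> K \<le> emeasure \<omega> K"
      using m[OF cpt[OF that]] cpt[OF that] sets_w by (auto intro: emeasure_mono)
    with fin[OF that] show ?thesis by order
  qed
  ultimately show ?thesis
    unfolding radon_measure_def using sets_m by blast
qed

lemma add_dirac_in_configurations:
  assumes w: "\<omega> \<in> configurations" and x: "x \<notin> points \<omega>"
  shows "add_measure \<omega> (dirac x) \<in> configurations"
    and "B \<in> sets borel \<Longrightarrow> emeasure (add_measure \<omega> (dirac x)) B = emeasure \<omega> B + indicator B x"
proof -
  show m: "emeasure (add_measure \<omega> (dirac x)) B = emeasure \<omega> B + indicator B x"
    if "B \<in> sets borel" for B
    using that sets_configuration[OF w] by (simp add: emeasure_add_measure)
  \<comment> \<open>As \<open>x\<close> is a new point, inserting it raises the count by exactly one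
    when \<open>x \<in> B\<close>; the points remain distinct.\<close>
  have "emeasure (count_space UNIV) (B \<inter> points \<omega>) + indicator B x =
      emeasure (count_space UNIV) (B \<inter> insert x (points \<omega>))" for B
    using x emeasure_insert[of x "count_space UNIV" "B \<inter> points \<omega>"]
    by (cases "x \<in> B") (auto simp: ac_simps)
  with m have "\<forall>B\<in>sets borel. emeasure (add_measure \<omega> (dirac x)) B =
      emeasure (count_space UNIV) (B \<inter> insert x (points \<omega>))"
    using w by (simp add: emeasure_configuration)
  moreover have "radon_measure (add_measure \<omega> (dirac x))"
    using w radon_measure_add_dirac by (auto simp: configurations_iff_countable_set)
  ultimately show "add_measure \<omega> (dirac x) \<in> configurations"
    using countable_points[OF w] unfolding configurations_iff_countable_set
    by (intro conjI exI[of _ "insert x (points \<omega>)"]) auto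
qed

text \<open>Each point of a configuration has mass exactly one, so subtracting the Dirac measure
  deletes it. Finiteness of \<omega> gives access to the formula for
  \<open>diff_measure\<close>.\<close>

lemma diff_dirac_in_configurations:
  assumes w: "\<omega> \<in> configurations" and fin: "finite_measure \<omega>" and x: "x \<in> points \<omega>"
  shows "diff_measure \<omega> (dirac x) \<in> configurations"
    and "B \<in> sets borel \<Longrightarrow> emeasure (diff_measure \<omega> (dirac x)) B = emeasure \<omega> B - indicator B x"
proof -
  have split: "emeasure \<omega> B = emeasure \<omega> (B - {x}) + indicator B x" if B: "B \<in> sets borel" for B
  proof (cases "x \<in> B")
    case True
    have "B \<inter> points \<omega> = insert x ((B - {x}) \<inter> points \<omega>)" using True x by auto
    then show ?thesis
      using B w True emeasure_insert[of x "count_space UNIV" "(B - {x}) \<inter> points \<omega>"]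
      by (simp add: emeasure_configuration ac_simps)
  qed simp
  show m: "emeasure (diff_measure \<omega> (dirac x)) B = emeasure \<omega> B - indicator B x"
    if "B \<in> sets borel" for B
  proof (rule trans[OF emeasure_diff_measure[OF fin]])
    show "finite_measure (dirac x)"
      by (simp add: prob_space.finite_measure prob_space_return)
    show "emeasure (dirac x) A \<le> emeasure \<omega> A" if "A \<in> sets \<omega>" for A
    proof -
      have "A \<in> sets borel" using that sets_configuration[OF w] by simp
      then show ?thesis by (subst split) simp_all
    qed
  qed (use that sets_configuration[OF w] in auto)
  \<comment> \<open>Subtraction in \<open>ennreal\<close> undoes the addition in
    \<open>split\<close> because the indicator is finite.\<close>
  have m': "emeasure (diff_measure \<omega> (dirac x)) B = emeasure \<omega> (B - {x})" if "B \<in> sets borel" for B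
    using m[OF that] split[OF that] by (simp add: indicator_def)
  have "radon_measure (diff_measure \<omega> (dirac x))"
    using w sets_configuration[OF w] unfolding configurations_iff_countable_set
    by (intro radon_measure_remove_point[OF _ _ m']) simp_all
  moreover have "emeasure (diff_measure \<omega> (dirac x)) B = emeasure (count_space UNIV) (B \<inter> (points \<omega> - {x}))"
    if "B \<in> sets borel" for B
  proof -
    have "(B - {x}) \<inter> points \<omega> = B \<inter> (points \<omega> - {x})" by auto
    then show ?thesis
      using m'[OF that] emeasure_configuration[OF w, of "B - {x}"] that by simp
  qed
  ultimately show "diff_measure \<omega> (dirac x) \<in> configurations"
    using countable_points[OF w] unfolding configurations_iff_countable_set
    by (intro conjI exI[of _ "points \<omega> - {x}"]) auto
qed

section \<open>Measurability on the configuration space\<close>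

lemma sets_config_space:
  "sets config_space = sigma_sets configurations
    {{\<omega> \<in> configurations. emeasure \<omega> B \<in> A} | B A. B \<in> sets borel \<and> A \<in> sets borel}"
  unfolding config_space_def by (rule sets_measure_of) auto

lemma space_config_space: "space config_space = configurations"
  unfolding config_space_def by (rule space_measure_of) auto

lemma borel_measurable_emeasure_config_space:
  assumes "B \<in> sets borel"
  shows "(\<lambda>\<omega>. emeasure \<omega> B) \<in> borel_measurable config_space"
proof (rule measurableI)
  fix A :: "ennreal set" assume "A \<in> sets borel"
  then show "(\<lambda>\<omega>. emeasure \<omega> B) -` A \<inter> space config_space \<in> sets config_space"
    using assms unfolding sets_config_space space_config_space
    by (intro sigma_sets.Basic) auto
qed simp

text \<open>The counts generate the \<sigma>-algebra, so it lies in the pullback of the product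
  \<sigma>-algebra under the map sending \<omega> to all its counts. The gain is that
  \<open>f\<close> also accepts families of values in which \<omega> and \<open>x\<close> enter
  separately.\<close>

lemma borel_measurable_config_space_factor:
  fixes F :: "'a::metric_space measure \<Rightarrow> real"
  assumes F: "F \<in> borel_measurable config_space"
  obtains f where "f \<in> borel_measurable (Pi\<^sub>M (sets (borel :: 'a measure)) (\<lambda>_. borel :: ennreal measure))"
    and "\<And>\<omega>. \<omega> \<in> configurations \<Longrightarrow> F \<omega> = f (restrict (emeasure \<omega>) (sets borel))"
proof -
  let ?P = "Pi\<^sub>M (sets (borel :: 'a measure)) (\<lambda>_. borel :: ennreal measure)"
  let ?g = "\<lambda>\<omega> :: 'a measure. restrict (emeasure \<omega>) (sets borel)"
  let ?V = "vimage_algebra configurations ?g ?P"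
  have g: "?g \<in> configurations \<rightarrow> space ?P" by (auto simp: space_PiM)
  have "sets config_space \<subseteq> sets ?V"
    unfolding sets_config_space
  proof (rule sets.sigma_sets_subset'[of _ ?V])
    show "configurations \<in> sets ?V"
      using sets.top[of ?V] by simp
    show "{{\<omega> \<in> configurations. emeasure \<omega> B \<in> A} | B A. B \<in> sets borel \<and> A \<in> sets borel} \<subseteq> sets ?V"
    proof safe
      fix B :: "'a set" and A :: "ennreal set"
      assume B: "B \<in> sets borel" and A: "A \<in> sets borel"
      have "(\<lambda>h. h B) -` A \<inter> space ?P \<in> sets ?P"
        using B A by measurable
      then have "?g -` ((\<lambda>h. h B) -` A \<inter> space ?P) \<inter> configurations \<in> sets ?V"
        by (rule in_vimage_algebra)
      also have "?g -` ((\<lambda>h. h B) -` A \<inter> space ?P) \<inter> configurations =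
          {\<omega> \<in> configurations. emeasure \<omega> B \<in> A}"
        using B g by auto
      finally show "{\<omega> \<in> configurations. emeasure \<omega> B \<in> A} \<in> sets ?V" .
    qed
  qed
  then have "F \<in> borel_measurable ?V"
    using F unfolding measurable_def by (auto simp: space_config_space)
  from borel_measurable_vimage_algebra_factor[OF g this] that show thesis by metis
qed

section \<open>Almost sure finiteness of Poisson configurations\<close>

text \<open>The probabilities that the total count equals \<open>k\<close> sum to one by the
  exponential series, so the count is almost surely a natural number.\<close>

lemma AE_poisson_finite_measure:
  assumes "poisson_measure \<sigma> \<pi>"
  shows "AE \<omega> in \<pi>. finite_measure \<omega>"
proof -
  interpret prob_space \<pi> using assms by (simp add: poisson_measure_def)
  have sets_pi: "sets \<pi> = sets config_space" using assms by (simp add: poisson_measure_def)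
  have space_pi: "space \<pi> = configurations"
    using sets_eq_imp_space_eq[OF sets_pi] by (simp add: space_config_space)
  have [measurable]: "(\<lambda>\<omega>. emeasure \<omega> UNIV) \<in> borel_measurable \<pi>"
    unfolding measurable_cong_sets[OF sets_pi refl]
    by (rule borel_measurable_emeasure_config_space) simp
  define A where "A k = {\<omega> \<in> space \<pi>. emeasure \<omega> UNIV = of_nat k}" for k :: nat
  have A: "A k \<in> sets \<pi>" for k unfolding A_def by measurable
  have "(\<lambda>k. measure \<pi> (A k)) sums measure \<pi> (\<Union>k. A k)"
    by (rule finite_measure_UNION) (use A in \<open>auto simp: disjoint_family_on_def A_def\<close>)
  moreover have "measure \<pi> (A k) = exp (- measure \<sigma> UNIV) * (measure \<sigma> UNIV ^ k /\<^sub>R fact k)" for k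
    using assms unfolding poisson_measure_def A_def by (simp add: divide_inverse)
  then have "(\<lambda>k. measure \<pi> (A k)) sums (exp (- measure \<sigma> UNIV) * exp (measure \<sigma> UNIV))"
    using sums_mult[OF exp_converges[of "measure \<sigma> UNIV"]] by simp
  ultimately have "measure \<pi> (\<Union>k. A k) = 1"
    using sums_unique2 by (fastforce simp flip: exp_add)
  then have "AE \<omega> in \<pi>. \<omega> \<in> (\<Union>k. A k)"
    using A by (subst AE_in_set_eq_1) auto
  then show ?thesis
  proof eventually_elim
    case (elim \<omega>)
    then obtain k where "\<omega> \<in> configurations" "emeasure \<omega> UNIV = of_nat k"
      by (auto simp: A_def space_pi)
    then show ?case
      using sets_eq_imp_space_eq[OF sets_configuration[of \<omega>]]
      by (intro finite_measureI) simp
  qed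
qed

section \<open>The coarea formula for the difference operator\<close>

text \<open>This treats both norms at once. In \<open>nbr\<close> the neighbour
  \<open>\<omega>'\<close> is chosen before \<open>H\<close>, so one neighbour and one exceptional
  null set serve \<open>F\<close> and all indicators of \<open>{\<omega>. F \<omega> > t}\<close>.
  Only the value \<open>G (\<omega>, x)\<close>, not \<open>\<omega>'\<close> itself, has to depend
  measurably on \<open>(\<omega>, x)\<close>.\<close>

lemma coarea_L1_finite_kernel:
  fixes \<pi> :: "'a::metric_space measure measure" and F :: "'a measure \<Rightarrow> real"
    and K :: "'a measure \<Rightarrow> 'a measure" and G :: "'a measure \<times> 'a \<Rightarrow> real"
  assumes \<pi>: "sigma_finite_measure \<pi>"
    and sets_K: "\<And>\<omega>. \<omega> \<in> space \<pi> \<Longrightarrow> sets (K \<omega>) = sets borel"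
    and fin: "\<And>\<omega>. \<omega> \<in> space \<pi> \<Longrightarrow> finite_measure (K \<omega>)"
    and K: "\<And>B. B \<in> sets borel \<Longrightarrow> (\<lambda>\<omega>. emeasure (K \<omega>) B) \<in> borel_measurable \<pi>"
    and F: "F \<in> borel_measurable \<pi>"
    and G: "G \<in> borel_measurable (\<pi> \<Otimes>\<^sub>M borel)"
    and nbr: "AE \<omega> in \<pi>. AE x in K \<omega>.
      \<exists>\<omega>'. G (\<omega>, x) = F \<omega>' \<and> (\<forall>H. diff_op H x \<omega> = H \<omega> - H \<omega>')"
  shows "(\<integral>\<^sup>+ \<omega>. L1_pos F \<omega> (K \<omega>) \<partial>\<pi>) =
           (\<integral>\<^sup>+ t. (\<integral>\<^sup>+ \<omega>. L1_pos (indicator {\<omega>. F \<omega> > t}) \<omega> (K \<omega>) \<partial>\<pi>) \<partial>lborel)"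
    and "(\<integral>\<^sup>+ \<omega>. L1_neg F \<omega> (K \<omega>) \<partial>\<pi>) =
           (\<integral>\<^sup>+ t. (\<integral>\<^sup>+ \<omega>. L1_neg (indicator {\<omega>. F \<omega> > t}) \<omega> (K \<omega>) \<partial>\<pi>) \<partial>lborel)"
proof -
  have F': "(\<lambda>z. F (fst z)) \<in> borel_measurable (\<pi> \<Otimes>\<^sub>M (borel :: 'a measure))"
    by (rule measurable_compose[OF measurable_fst F])
  have pos: "(\<integral>\<^sup>+ \<omega>. L1_pos F \<omega> (K \<omega>) \<partial>\<pi>) =
      (\<integral>\<^sup>+ \<omega>. \<integral>\<^sup>+ x. ennreal (max 0 (F (fst (\<omega>, x)) - G (\<omega>, x))) \<partial>K \<omega> \<partial>\<pi>)"
    unfolding L1_pos_def diff_op_pos_def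
    by (intro nn_integral_cong_AE eventually_mono[OF nbr]) (erule eventually_mono, auto)
  have neg: "(\<integral>\<^sup>+ \<omega>. L1_neg F \<omega> (K \<omega>) \<partial>\<pi>) =
      (\<integral>\<^sup>+ \<omega>. \<integral>\<^sup>+ x. ennreal (max 0 (G (\<omega>, x) - F (fst (\<omega>, x)))) \<partial>K \<omega> \<partial>\<pi>)"
    unfolding L1_neg_def diff_op_neg_def
    by (intro nn_integral_cong_AE eventually_mono[OF nbr])
      (erule eventually_mono, auto simp: min_def max_def)
  \<comment> \<open>A difference of two indicators has positive part 1 exactly when \<open>F\<close>
    exceeds \<open>t\<close> at \<omega> but not at the neighbour. For the negative part
    \<open>F\<close> and \<open>G\<close> trade places.\<close>
  have pos_ind: "(\<integral>\<^sup>+ \<omega>. L1_pos (indicator {\<omega>. F \<omega> > t}) \<omega> (K \<omega>) \<partial>\<pi>) =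
      (\<integral>\<^sup>+ \<omega>. \<integral>\<^sup>+ x. (if G (\<omega>, x) \<le> t \<and> t < F (fst (\<omega>, x)) then 1 else 0) \<partial>K \<omega> \<partial>\<pi>)" for t
    unfolding L1_pos_def diff_op_pos_def
    by (intro nn_integral_cong_AE eventually_mono[OF nbr])
      (erule eventually_mono, auto simp: indicator_def ennreal_neg)
  have neg_ind: "(\<integral>\<^sup>+ \<omega>. L1_neg (indicator {\<omega>. F \<omega> > t}) \<omega> (K \<omega>) \<partial>\<pi>) =
      (\<integral>\<^sup>+ \<omega>. \<integral>\<^sup>+ x. (if F (fst (\<omega>, x)) \<le> t \<and> t < G (\<omega>, x) then 1 else 0) \<partial>K \<omega> \<partial>\<pi>)" for t
    unfolding L1_neg_def diff_op_neg_def
    by (intro nn_integral_cong_AE eventually_mono[OF nbr])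
      (erule eventually_mono, auto simp: indicator_def ennreal_neg)
  note coarea = coarea_finite_kernel[OF \<pi> sets_K fin K]
  show "(\<integral>\<^sup>+ \<omega>. L1_pos F \<omega> (K \<omega>) \<partial>\<pi>) =
      (\<integral>\<^sup>+ t. (\<integral>\<^sup>+ \<omega>. L1_pos (indicator {\<omega>. F \<omega> > t}) \<omega> (K \<omega>) \<partial>\<pi>) \<partial>lborel)"
    unfolding pos pos_ind by (rule coarea[OF _ _ _ F' G])
  show "(\<integral>\<^sup>+ \<omega>. L1_neg F \<omega> (K \<omega>) \<partial>\<pi>) =
      (\<integral>\<^sup>+ t. (\<integral>\<^sup>+ \<omega>. L1_neg (indicator {\<omega>. F \<omega> > t}) \<omega> (K \<omega>) \<partial>\<pi>) \<partial>lborel)"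
    unfolding neg neg_ind by (rule coarea[OF _ _ _ G F'])
qed

section \<open>The coarea identities on Poisson space\<close>

theorem lemma5p2:
  fixes \<sigma> :: "'a::metric_space measure"
    and \<pi> :: "'a measure measure"
    and F :: "'a measure \<Rightarrow> real"
  assumes "sets \<sigma> = sets borel"
    and "finite_measure \<sigma>"
    and "diffuse \<sigma>"
    and "poisson_measure \<sigma> \<pi>"
    and "F \<in> borel_measurable config_space"
  shows "(\<integral>\<^sup>+ \<omega>. L1_pos F \<omega> \<sigma> \<partial>\<pi>) =
           (\<integral>\<^sup>+ t. (\<integral>\<^sup>+ \<omega>. L1_pos (indicator {\<omega>. F \<omega> > t}) \<omega> \<sigma> \<partial>\<pi>) \<partial>lborel) \<and>
         (\<integral>\<^sup>+ \<omega>. L1_neg F \<omega> \<sigma> \<partial>\<pi>) =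
           (\<integral>\<^sup>+ t. (\<integral>\<^sup>+ \<omega>. L1_neg (indicator {\<omega>. F \<omega> > t}) \<omega> \<sigma> \<partial>\<pi>) \<partial>lborel) \<and>
         (\<integral>\<^sup>+ \<omega>. L1_pos F \<omega> \<omega> \<partial>\<pi>) =
           (\<integral>\<^sup>+ t. (\<integral>\<^sup>+ \<omega>. L1_pos (indicator {\<omega>. F \<omega> > t}) \<omega> \<omega> \<partial>\<pi>) \<partial>lborel) \<and>
         (\<integral>\<^sup>+ \<omega>. L1_neg F \<omega> \<omega> \<partial>\<pi>) =
           (\<integral>\<^sup>+ t. (\<integral>\<^sup>+ \<omega>. L1_neg (indicator {\<omega>. F \<omega> > t}) \<omega> \<omega> \<partial>\<pi>) \<partial>lborel)"
proof -
  interpret prob_space \<pi> using assms(4) by (simp add: poisson_measure_def)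
  have sets_\<pi>: "sets \<pi> = sets config_space" using assms(4) by (simp add: poisson_measure_def)
  have space_\<pi>: "space \<pi> = configurations"
    using sets_eq_imp_space_eq[OF sets_\<pi>] by (simp add: space_config_space)
  have F: "F \<in> borel_measurable \<pi>"
    unfolding measurable_cong_sets[OF sets_\<pi> refl] by fact
  have eval: "(\<lambda>\<omega>. emeasure \<omega> B) \<in> borel_measurable \<pi>" if "B \<in> sets borel" for B
    unfolding measurable_cong_sets[OF sets_\<pi> refl]
    using that by (rule borel_measurable_emeasure_config_space)
  obtain f where f: "f \<in> borel_measurable (Pi\<^sub>M (sets (borel :: 'a measure)) (\<lambda>_. borel :: ennreal measure))"
    and F_eq: "\<And>\<omega>. \<omega> \<in> configurations \<Longrightarrow> F \<omega> = f (restrict (emeasure \<omega>) (sets borel))"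
    using borel_measurable_config_space_factor[OF assms(5)] by metis
  define G_add where "G_add z = f (\<lambda>B\<in>sets borel. emeasure (fst z) B + indicator B (snd z))"
    for z :: "'a measure \<times> 'a"
  define G_del where "G_del z = f (\<lambda>B\<in>sets borel. emeasure (fst z) B - indicator B (snd z))"
    for z :: "'a measure \<times> 'a"
  have ev: "(\<lambda>z. emeasure (fst z) B) \<in> borel_measurable (\<pi> \<Otimes>\<^sub>M (borel :: 'a measure))"
    and ind: "(\<lambda>z. indicator B (snd z) :: ennreal) \<in> borel_measurable (\<pi> \<Otimes>\<^sub>M (borel :: 'a measure))"
    if "B \<in> sets borel" for B
    using that measurable_compose[OF measurable_fst eval] measurable_compose[OF measurable_snd, of _ borel]
    by auto
  \<comment> \<open>Measurability into the product space is checked one Borel set at a time, where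
    each coordinate combines a function of \<omega> with a function of \<open>x\<close>.\<close>
  have G_add: "G_add \<in> borel_measurable (\<pi> \<Otimes>\<^sub>M borel)"
    unfolding G_add_def
    by (intro measurable_compose[OF measurable_restrict f] borel_measurable_add ev ind)
  have G_del: "G_del \<in> borel_measurable (\<pi> \<Otimes>\<^sub>M borel)"
    unfolding G_del_def
    by (intro measurable_compose[OF measurable_restrict f] borel_measurable_minus_ennreal ev ind)

  have nbr_add: "AE \<omega> in \<pi>. AE x in \<sigma>.
      \<exists>\<omega>'. G_add (\<omega>, x) = F \<omega>' \<and> (\<forall>H. diff_op H x \<omega> = H \<omega> - H \<omega>')"
  proof (rule AE_I2)
    fix \<omega> assume "\<omega> \<in> space \<pi>"
    then have w: "\<omega> \<in> configurations" by (simp add: space_\<pi>)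
    \<comment> \<open>A countable union of \<sigma>-null singletons is null because \<sigma> is
      diffuse, so \<sigma>-almost every \<open>x\<close> falls in the addition branch of
      \<open>diff_op\<close>.\<close>
    have "(\<Union>x\<in>points \<omega>. {x}) \<in> null_sets \<sigma>"
      using assms(1,3) by (intro null_sets_UN' countable_points[OF w]) (auto simp: diffuse_def)
    then have "AE x in \<sigma>. x \<notin> points \<omega>"
      using AE_not_in by fastforce
    then show "AE x in \<sigma>. \<exists>\<omega>'. G_add (\<omega>, x) = F \<omega>' \<and> (\<forall>H. diff_op H x \<omega> = H \<omega> - H \<omega>')"
    proof eventually_elim
      case (elim x)
      have "G_add (\<omega>, x) = F (add_measure \<omega> (dirac x))"
        unfolding G_add_def F_eq[OF add_dirac_in_configurations(1)[OF w elim]]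
        by (intro arg_cong[of _ _ f] restrict_ext)
          (simp add: add_dirac_in_configurations(2)[OF w elim])
      with elim show ?case
        by (intro exI[of _ "add_measure \<omega> (dirac x)"]) (simp add: diff_op_def)
    qed
  qed

  \<comment> \<open>Infinite configurations form a \<open>\<pi>\<close>-null set; there the kernel is made finite by force.\<close>
  define K where "K \<omega> = (if emeasure \<omega> UNIV < \<infinity> then \<omega> else null_measure borel)" for \<omega> :: "'a measure"
  have K_AE: "AE \<omega> in \<pi>. K \<omega> = \<omega>"
    using AE_poisson_finite_measure[OF assms(4)] AE_space
  proof eventually_elim
    case (elim \<omega>)
    then show ?case
      using finite_measure.emeasure_finite[of \<omega> UNIV] by (simp add: K_def less_top)
  qed
  have nbr_del: "AE \<omega> in \<pi>. AE x in K \<omega>.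
      \<exists>\<omega>'. G_del (\<omega>, x) = F \<omega>' \<and> (\<forall>H. diff_op H x \<omega> = H \<omega> - H \<omega>')"
    using AE_poisson_finite_measure[OF assms(4)] K_AE AE_space
  proof eventually_elim
    case (elim \<omega>)
    then have fin: "finite_measure \<omega>" and w: "\<omega> \<in> configurations" and K: "K \<omega> = \<omega>"
      by (auto simp: space_\<pi>)
    show ?case
      unfolding K using AE_configuration_points[OF w]
    proof eventually_elim
      case (elim x)
      have "G_del (\<omega>, x) = F (diff_measure \<omega> (dirac x))"
        unfolding G_del_def F_eq[OF diff_dirac_in_configurations(1)[OF w fin elim]]
        by (intro arg_cong[of _ _ f] restrict_ext)
          (simp add: diff_dirac_in_configurations(2)[OF w fin elim])
      with elim show ?case
        by (intro exI[of _ "diff_measure \<omega> (dirac x)"]) (simp add: diff_op_def)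
    qed
  qed
  have K_sets: "sets (K \<omega>) = sets borel" if "\<omega> \<in> space \<pi>" for \<omega>
    using that by (simp add: K_def space_\<pi> sets_configuration)
  have K_fin: "finite_measure (K \<omega>)" if "\<omega> \<in> space \<pi>" for \<omega>
    using sets_eq_imp_space_eq[OF K_sets[OF that]]
    by (intro finite_measureI) (auto simp: K_def less_top)
  have K_eval: "(\<lambda>\<omega>. emeasure (K \<omega>) B) \<in> borel_measurable \<pi>" if "B \<in> sets borel" for B
  proof -
    note [measurable] = eval[OF that] eval[of UNIV, simplified]
    have "(\<lambda>\<omega>. if emeasure \<omega> UNIV < \<infinity> then emeasure \<omega> B else 0) \<in> borel_measurable \<pi>"
      by measurable
    also have "(\<lambda>\<omega>. if emeasure \<omega> UNIV < \<infinity> then emeasure \<omega> B else 0) = (\<lambda>\<omega>. emeasure (K \<omega>) B)"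
      by (auto simp: K_def)
    finally show ?thesis .
  qed
  \<comment> \<open>\<open>L\<close> is arbitrary so that the same replacement of
    \<open>K \<omega>\<close> by \<omega> applies to \<open>F\<close> and to the indicator at every
    level \<open>t\<close>.\<close>
  have K_cong: "(\<integral>\<^sup>+ \<omega>. L \<omega> (K \<omega>) \<partial>\<pi>) = (\<integral>\<^sup>+ \<omega>. L \<omega> \<omega> \<partial>\<pi>)"
    for L :: "'a measure \<Rightarrow> 'a measure \<Rightarrow> ennreal"
    using K_AE by (intro nn_integral_cong_AE) (auto elim!: eventually_mono)

  \<comment> \<open>The constant kernel \<sigma> with added points gives the first two identities;
    the kernel \<open>K\<close> with deleted points gives the other two.\<close>
  note add = coarea_L1_finite_kernel[OF sigma_finite_measure_axioms assms(1,2) borel_measurable_const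
      F G_add nbr_add]
  note del = coarea_L1_finite_kernel[OF sigma_finite_measure_axioms K_sets K_fin K_eval
      F G_del nbr_del, unfolded K_cong]
  show ?thesis
    by (intro conjI add del)
qed

end
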